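(* Let $b\in\mathscr{S}(n)$, $\alpha\in\mathcal{U}(n)$ and $\lambda\in\mathbb{T}$. Then $$\operatorname{Ran}\boldsymbol{\mu}^\alpha\{\lambda\}=\mathbf{E}_\alpha(\lambda).$$
   Context: $\mathbb{D}$ is the open unit disc and $\mathbb{T}=\partial\mathbb{D}$. $\mathscr{S}(n)$ is the set of bounded analytic $n\times n$ matrix-valued functions $b$ on $\mathbb{D}$ with $\|b(z)\|<1$ (operator norm) for all $z\in\mathbb{D}$. $\mathcal{U}(n)$ is the group of unitary $n\times n$ matrices. For $b\in\mathscr{S}(n)$ and $\alpha\in\mathcal{U}(n)$, the Aleksandrov--Clark measure $\boldsymbol{\mu}^\alpha$ is the unique finite non-negative $\mathbb{C}^{n\times n}$-valued Borel measure on $\mathbb{T}$ such that, with $H_\alpha(z)=(I_n+b(z)\alpha^* )(I_n-b(z)\alpha^* )^{-1}$, $$H_\alpha(z)=i\,\mathrm{Im}\,H_\alpha(0)+\int_{\mathbb{T}}\frac{\zeta+z}{\zeta-z}\,\boldsymbol{\mu}^\alpha(\mathrm{d}\zeta),\qquad z\in\mathbb{D},$$ where $\mathrm{Im}\,A=(A-A^* )/(2i)$. We write $\boldsymbol{\mu}^\alpha\{\lambda\}=\boldsymbol{\mu}^\alpha(\{\lambda\})$. Non-tangential ("n.t.") approach $z\to\lambda$ means approach from within Stolz regions $\Gamma_t(\lambda)=\{z\in\mathbb{D}:|z-\lambda|<t(1-|z|)\}$, $t>1$; a non-tangential limit is a limit from within every such region. $b$ satisfies the Carathéodory condition in the codirection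 $\mathbf{x}\in\mathbb{C}^n$ at $\lambda$ if $$\liminf_{z\to\lambda\ \text{n.t.}}\frac{\|\mathbf{x}\|^2-\|b(z)^*\mathbf{x}\|^2}{1-|z|^2}<\infty,$$ i.e. there is a sequence $z_k\to\lambda$ contained in some Stolz region at $\lambda$ along which the quotient stays bounded. Finally, $$\mathbf{S}_\alpha(\lambda)=\Big\{\mathbf{e}\in\mathbb{C}^n:\lim_{z\to\lambda\ \text{n.t.}}b(z)^*\mathbf{e}=\alpha^*\mathbf{e}\Big\},$$ $$\mathbf{E}_\alpha(\lambda)=\{\mathbf{x}\in\mathbf{S}_\alpha(\lambda):b\text{ satisfies the Carathéodory condition at }\lambda\text{ in codirection }\mathbf{x}\}.$$ *)

theory Defs
  imports "HOL-Complex_Analysis.Complex_Analysis"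
begin

section \<open>Complex matrices\<close>

text \<open>The norm of \<^typ>\<open>complex ^ 'n\<close> is the Euclidean norm, so \<open>onorm ((*v) A)\<close> is the
  operator norm of \<open>A\<close>. (The norm of \<open>A\<close> itself is the Frobenius norm.)\<close>

definition cdot :: "complex ^ 'n \<Rightarrow> complex ^ 'n \<Rightarrow> complex" where
  "cdot x y = (\<Sum>i\<in>UNIV. x $ i * cnj (y $ i))"

definition cadj :: "complex ^ 'n ^ 'm \<Rightarrow> complex ^ 'm ^ 'n" where
  "cadj A = (\<chi> i j. cnj (A $ j $ i))"

definition unitary :: "complex ^ 'n ^ 'n \<Rightarrow> bool" where
  "unitary A \<longleftrightarrow> cadj A ** A = mat 1 \<and> A ** cadj A = mat 1"

definition nonneg_mat :: "complex ^ 'n ^ 'n \<Rightarrow> bool" where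
  "nonneg_mat A \<longleftrightarrow> (\<forall>x. cdot (A *v x) x \<in> \<real>\<^sub>\<ge>\<^sub>0)"

definition Im_mat :: "complex ^ 'n ^ 'n \<Rightarrow> complex ^ 'n ^ 'n" where
  "Im_mat A = (\<chi> j k. (A $ j $ k - cadj A $ j $ k) / (2 * \<i>))"

lemma cdot_mat_vec: "cdot (A *v x) y = cdot x (cadj A *v y)"
  unfolding cdot_def cadj_def matrix_vector_mult_def
  by (simp add: sum_distrib_left sum_distrib_right, subst sum.swap, simp add: ac_simps)

section \<open>Matrix-valued measures on the unit circle\<close>

abbreviation circle_borel :: "complex measure" where
  "circle_borel \<equiv> restrict_space borel (sphere 0 1)"

text \<open>A matrix-valued measure is a set function, of which only the values on the Borel subsets of
  the circle matter. Finiteness is automatic, as the values are matrices.\<close>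

definition nonneg_mat_measure :: "(complex set \<Rightarrow> complex ^ 'n ^ 'n) \<Rightarrow> bool" where
  "nonneg_mat_measure \<mu> \<longleftrightarrow>
     (\<forall>A\<in>sets circle_borel. nonneg_mat (\<mu> A)) \<and>
     (\<forall>A :: nat \<Rightarrow> complex set. range A \<subseteq> sets circle_borel \<longrightarrow> disjoint_family A \<longrightarrow>
        (\<lambda>k. \<mu> (A k)) sums \<mu> (\<Union>k. A k))"

text \<open>The finite positive scalar measure \<open>A \<mapsto> \<langle>\<mu>(A) x, x\<rangle>\<close>.\<close>

definition quad_measure ::
    "(complex set \<Rightarrow> complex ^ 'n ^ 'n) \<Rightarrow> complex ^ 'n \<Rightarrow> complex measure" where
  "quad_measure \<mu> x =
     measure_of (sphere 0 1) (sets circle_borel) (\<lambda>A. ennreal (Re (cdot (\<mu> A *v x) x)))"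

text \<open>The matrix \<open>J\<close> is the integral \<open>\<integral> f d\<mu>\<close> of the scalar function \<open>f\<close>, which is defined through
  its quadratic form. By polarization this determines \<open>J\<close> and agrees with integrating against the
  entries of \<open>\<mu>\<close>; see \<open>has_mat_integral_unique\<close>.\<close>

definition has_mat_integral ::
    "(complex set \<Rightarrow> complex ^ 'n ^ 'n) \<Rightarrow> (complex \<Rightarrow> complex) \<Rightarrow> complex ^ 'n ^ 'n \<Rightarrow> bool" where
  "has_mat_integral \<mu> f J \<longleftrightarrow>
     (\<forall>x. integrable (quad_measure \<mu> x) f \<and> cdot (J *v x) x = (LINT \<zeta>|quad_measure \<mu> x. f \<zeta>))"

lemma space_quad_measure [simp]: "space (quad_measure \<mu> x) = sphere 0 1"
  unfolding quad_measure_def by (rule space_measure_of) (auto simp: sets_restrict_space)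

lemma sets_quad_measure [simp]: "sets (quad_measure \<mu> x) = sets circle_borel"
  unfolding quad_measure_def
  using sets.sets_measure_of_eq[of circle_borel] by (simp add: space_restrict_space)

lemma bounded_linear_cdot_mat: "bounded_linear (\<lambda>A :: complex ^ 'n ^ 'n. cdot (A *v x) x)"
  unfolding cdot_def matrix_vector_mult_def
  by (simp, intro bounded_linear_sum bounded_linear_mult_const
      bounded_linear_compose[OF bounded_linear_vec_nth] bounded_linear_vec_nth)

lemma emeasure_quad_measure:
  assumes "nonneg_mat_measure \<mu>" and "A \<in> sets circle_borel"
  shows "emeasure (quad_measure \<mu> x) A = ennreal (Re (cdot (\<mu> A *v x) x))"
proof -
  let ?q = "\<lambda>A. Re (cdot (\<mu> A *v x) x)"
  have nn: "?q B \<ge> 0" if "B \<in> sets circle_borel" for B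
    using assms that unfolding nonneg_mat_measure_def nonneg_mat_def
    by (metis complex_nonneg_Reals_iff)
  have sums: "(\<lambda>k. ?q (B k)) sums ?q (\<Union>k. B k)"
    if "range B \<subseteq> sets circle_borel" "disjoint_family B" for B :: "nat \<Rightarrow> _"
  proof -
    have "(\<lambda>k. \<mu> (B k)) sums \<mu> (\<Union>k. B k)"
      using assms that unfolding nonneg_mat_measure_def by blast
    then show ?thesis
      by (intro sums_Re bounded_linear.sums[OF bounded_linear_cdot_mat])
  qed
  have "?q {} = 0"
  proof -
    have "(\<lambda>k::nat. ?q {}) sums ?q {}"
      using sums[of "\<lambda>_. {}"] by (simp add: disjoint_family_on_def)
    then have "(\<lambda>k::nat. ?q {}) \<longlonglongrightarrow> 0"
      using sums_summable summable_LIMSEQ_zero by blast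
    then show ?thesis using LIMSEQ_unique tendsto_const by blast
  qed
  then have "positive (sets circle_borel) (\<lambda>A. ennreal (?q A))"
    by (simp add: positive_def)
  moreover have "countably_additive (sets circle_borel) (\<lambda>A. ennreal (?q A))"
  proof (rule countably_additiveI)
    fix B :: "nat \<Rightarrow> complex set"
    assume B: "range B \<subseteq> sets circle_borel" "disjoint_family B"
    show "(\<Sum>k. ennreal (?q (B k))) = ennreal (?q (\<Union>k. B k))"
      using B by (intro suminf_ennreal_eq sums nn) auto
  qed
  moreover have "sigma_algebra (sphere 0 1 :: complex set) (sets circle_borel)"
    using sets.sigma_algebra_axioms[of circle_borel] by (simp add: space_restrict_space)
  ultimately show ?thesis
    unfolding quad_measure_def using assms(2) by (intro emeasure_measure_of_sigma)
qed

lemma cdot_mat_eqI: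
  fixes A B :: "complex ^ 'n ^ 'n"
  assumes "\<And>x. cdot (A *v x) x = cdot (B *v x) x"
  shows "A = B"
proof -
  define D where "D = A - B"
  have z: "cdot (D *v x) x = 0" for x
    using assms[of x]
    by (simp add: D_def matrix_vector_mult_diff_rdistrib cdot_def left_diff_distrib sum_subtractf)
  have add: "cdot (x + y) w = cdot x w + cdot y w" "cdot w (x + y) = cdot w x + cdot w y"
    for x y w :: "complex ^ 'n"
    by (simp_all add: cdot_def algebra_simps sum.distrib)
  have scale: "cdot (c *s x) y = c * cdot x y" "cdot x (c *s y) = cnj c * cdot x y"
    for c and x y :: "complex ^ 'n"
    by (simp_all add: cdot_def sum_distrib_left ac_simps)
  have polar: "cdot (D *v x) y = 0" for x y
  proof -
    have 1: "cdot (D *v x) y + cdot (D *v y) x = 0"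
      using z[of "x + y"] by (simp add: matrix_vector_right_distrib add z add.commute)
    have "cdot (D *v x) (\<i> *s y) + cdot (D *v (\<i> *s y)) x = 0"
      using z[of "x + \<i> *s y"] z[of "\<i> *s y"]
      by (simp add: matrix_vector_right_distrib add z add.commute)
    then have "\<i> * (cdot (D *v y) x - cdot (D *v x) y) = 0"
      by (simp add: vector_scalar_commute scale algebra_simps)
    then show ?thesis using 1 by simp
  qed
  have "D *v x = 0" for x
  proof -
    have "(\<Sum>i\<in>UNIV. (D *v x) $ i * cnj ((D *v x) $ i)) = 0"
      using polar[of x "D *v x"] by (simp add: cdot_def)
    then have "complex_of_real (\<Sum>i\<in>UNIV. (norm ((D *v x) $ i))\<^sup>2) = 0"
      by (simp only: of_real_sum complex_norm_square)
    then have "(\<Sum>i\<in>UNIV. (norm ((D *v x) $ i))\<^sup>2) = 0"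
      by (simp only: of_real_eq_0_iff)
    then show ?thesis
      by (simp add: sum_nonneg_eq_0_iff vec_eq_iff)
  qed
  then have "A *v x = B *v x" for x
    by (simp add: D_def matrix_vector_mult_diff_rdistrib)
  then show ?thesis by (simp add: matrix_eq)
qed

lemma has_mat_integral_unique:
  "has_mat_integral \<mu> f J \<Longrightarrow> has_mat_integral \<mu> f K \<Longrightarrow> J = K"
  unfolding has_mat_integral_def by (intro cdot_mat_eqI) simp

section \<open>Schur class and Aleksandrov--Clark measures\<close>

definition schur_class :: "(complex \<Rightarrow> complex ^ 'n ^ 'n) \<Rightarrow> bool" where
  "schur_class b \<longleftrightarrow>
     (\<forall>i j. (\<lambda>z. b z $ i $ j) holomorphic_on ball 0 1) \<and> bounded (b ` ball 0 1) \<and>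
     (\<forall>z\<in>ball 0 1. onorm ((*v) (b z)) < 1)"

definition H_fun ::
    "(complex \<Rightarrow> complex ^ 'n ^ 'n) \<Rightarrow> complex ^ 'n ^ 'n \<Rightarrow> complex \<Rightarrow> complex ^ 'n ^ 'n" where
  "H_fun b \<alpha> z = (mat 1 + b z ** cadj \<alpha>) ** matrix_inv (mat 1 - b z ** cadj \<alpha>)"

text \<open>\<open>mat \<i> ** A\<close> is the scalar multiple \<open>\<i> A\<close>.
  The measure is characterized by its Herglotz representation, which determines its values on
  Borel subsets of the circle.\<close>

definition AC_measure ::
    "(complex \<Rightarrow> complex ^ 'n ^ 'n) \<Rightarrow> complex ^ 'n ^ 'n \<Rightarrow>
     (complex set \<Rightarrow> complex ^ 'n ^ 'n) \<Rightarrow> bool" where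
  "AC_measure b \<alpha> \<mu> \<longleftrightarrow> nonneg_mat_measure \<mu> \<and>
     (\<forall>z\<in>ball 0 1. \<exists>J. has_mat_integral \<mu> (\<lambda>\<zeta>. (\<zeta> + z) / (\<zeta> - z)) J \<and>
        H_fun b \<alpha> z = mat \<i> ** Im_mat (H_fun b \<alpha> 0) + J)"

section \<open>Non-tangential limits and the Caratheodory condition\<close>

definition stolz :: "real \<Rightarrow> complex \<Rightarrow> complex set" where
  "stolz t l = {z \<in> ball 0 1. norm (z - l) < t * (1 - norm z)}"

definition nt_tendsto ::
    "(complex \<Rightarrow> 'a :: topological_space) \<Rightarrow> 'a \<Rightarrow> complex \<Rightarrow> bool" where
  "nt_tendsto f L l \<longleftrightarrow> (\<forall>t>1. (f \<longlongrightarrow> L) (at l within stolz t l))"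

text \<open>Finiteness of the non-tangential limes inferior: boundedness of the difference quotient
  along some sequence that tends to \<open>l\<close> within some Stolz region.\<close>

definition caratheodory ::
    "(complex \<Rightarrow> complex ^ 'n ^ 'n) \<Rightarrow> complex \<Rightarrow> complex ^ 'n \<Rightarrow> bool" where
  "caratheodory b l x \<longleftrightarrow>
     (\<exists>t>1. \<exists>z :: nat \<Rightarrow> complex. (\<forall>k. z k \<in> stolz t l) \<and> z \<longlonglongrightarrow> l \<and>
        bounded (range (\<lambda>k. ((norm x)\<^sup>2 - (norm (cadj (b (z k)) *v x))\<^sup>2) / (1 - (norm (z k))\<^sup>2))))"

definition S_set ::
    "(complex \<Rightarrow> complex ^ 'n ^ 'n) \<Rightarrow> complex ^ 'n ^ 'n \<Rightarrow> complex \<Rightarrow> (complex ^ 'n) set" where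
  "S_set b \<alpha> l = {e. nt_tendsto (\<lambda>z. cadj (b z) *v e) (cadj \<alpha> *v e) l}"

definition E_set ::
    "(complex \<Rightarrow> complex ^ 'n ^ 'n) \<Rightarrow> complex ^ 'n ^ 'n \<Rightarrow> complex \<Rightarrow> (complex ^ 'n) set" where
  "E_set b \<alpha> l = {x \<in> S_set b \<alpha> l. caratheodory b l x}"

end

theory Submission
  imports Defs
begin

text \<open>
  Put \<open>B(z) = b(z) \<alpha>*\<close> and \<open>G(z) = (I - B(z))\<^sup>-\<^sup>1\<close>, so that \<open>H = 2 G - I\<close>. By dominated convergence in the
  Herglotz representation \<open>(1 - cnj l z) G(z)\<close> tends non-tangentially to \<open>\<mu>{l}\<close>. For the defect vector
  \<open>d = e - B(z)* e\<close> we have \<open>G(z)* d = e\<close>, and the real part of the representation shows that the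
  Caratheodory quotient of \<open>e\<close> at \<open>z\<close> is \<open>\<integral> |\<zeta> - z|\<^sup>-\<^sup>2\<close> against the scalar measure \<open>\<langle>\<mu> d, d\<rangle>\<close>.

  If \<open>e = \<mu>{l} x\<close>, comparison with the point mass at \<open>l\<close> bounds this quotient. Conversely, if \<open>e\<close> is in
  \<open>E_set\<close> and \<open>\<mu>{l} w = 0\<close>, then \<open>\<langle>w, e\<rangle> = \<langle>G(z) w, d\<rangle>\<close>, and a Cauchy--Schwarz inequality for \<open>\<mu>\<close> makes
  the right-hand side tend to zero along the sequence of the Caratheodory condition. So \<open>e\<close> is
  orthogonal to the kernel of the self-adjoint matrix \<open>\<mu>{l}\<close>.
\<close>

section \<open>The sesquilinear form and adjoints\<close>

lemma cdot_add_left: "cdot (x + y) z = cdot x z + cdot y z"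
  by (simp add: cdot_def algebra_simps sum.distrib)

lemma cdot_add_right: "cdot x (y + z) = cdot x y + cdot x z"
  by (simp add: cdot_def algebra_simps sum.distrib)

lemma cdot_diff_left: "cdot (x - y) z = cdot x z - cdot y z"
  by (simp add: cdot_def algebra_simps sum_subtractf)

lemma cdot_diff_right: "cdot x (y - z) = cdot x y - cdot x z"
  by (simp add: cdot_def algebra_simps sum_subtractf)

lemma cdot_scale_left: "cdot (c *s x) y = c * cdot x y"
  by (simp add: cdot_def sum_distrib_left ac_simps)

lemma cdot_scale_right: "cdot x (c *s y) = cnj c * cdot x y"
  by (simp add: cdot_def sum_distrib_left ac_simps)

lemmas cdot_simps = cdot_add_left cdot_add_right cdot_diff_left cdot_diff_right
  cdot_scale_left cdot_scale_right

lemma cnj_cdot: "cnj (cdot x y) = cdot y x"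
  by (simp add: cdot_def mult.commute)

lemma inner_eq_Re_cdot: "x \<bullet> y = Re (cdot x y)"
  by (simp add: inner_vec_def cdot_def inner_complex_def)

lemma cdot_self: "cdot x x = complex_of_real ((norm x)\<^sup>2)"
proof (rule complex_eqI)
  show "Re (cdot x x) = Re (complex_of_real ((norm x)\<^sup>2))"
    by (simp add: power2_norm_eq_inner inner_eq_Re_cdot)
  have "Im (cdot x x) = - Im (cdot x x)"
    by (metis cnj_cdot cnj.simps(2))
  then show "Im (cdot x x) = Im (complex_of_real ((norm x)\<^sup>2))"
    by simp
qed

lemma cdot_axis: "cdot x (axis i 1) = x $ i"
  by (simp add: cdot_def axis_def if_distrib sum.delta cong: if_cong)

lemma norm_vector_scale: "norm (c *s x) = norm c * norm (x :: complex ^ 'n)"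
  by (simp add: norm_vec_def norm_mult L2_set_right_distrib)

lemma cadj_cadj [simp]: "cadj (cadj A) = A"
  by (simp add: cadj_def vec_eq_iff)

lemma cdot_vec_mat: "cdot x (A *v y) = cdot (cadj A *v x) y"
  by (simp add: cdot_mat_vec)

lemma cadj_diff: "cadj (A - B) = cadj A - cadj B"
  by (simp add: cadj_def vec_eq_iff)

lemma cadj_mult: "cadj (A ** B) = cadj B ** cadj A"
  by (simp add: cadj_def vec_eq_iff matrix_matrix_mult_def mult.commute)

lemma cadj_mat_1 [simp]: "cadj (mat 1) = mat 1"
  by (auto simp add: cadj_def vec_eq_iff mat_def)

lemma mat_vec: "mat c *v x = c *s (x :: complex ^ 'n)"
  by (simp add: vec_eq_iff matrix_vector_mult_def mat_def if_distrib[of "\<lambda>a. a * _"] cong: if_cong)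

text \<open>A real quadratic form equals its conjugate, which is the form of the adjoint, and over
  the complex numbers the form determines the matrix.\<close>

lemma nonneg_mat_self_adjoint:
  assumes "nonneg_mat A"
  shows "cadj A = A"
proof (rule cdot_mat_eqI)
  fix x
  have "cdot (A *v x) x \<in> \<real>"
    using assms by (auto simp: nonneg_mat_def complex_nonneg_Reals_iff complex_is_Real_iff)
  then show "cdot (cadj A *v x) x = cdot (A *v x) x"
    by (metis cdot_vec_mat cnj_cdot Reals_cnj_iff)
qed

lemma Im_mat_self_adjoint: "cadj (Im_mat A) = Im_mat A"
  by (simp add: cadj_def Im_mat_def vec_eq_iff) (simp add: field_simps)

section \<open>Polarization of limits\<close>

lemma polarization:
  "4 * cdot (A *v x) y =
     cdot (A *v (x + y)) (x + y) - cdot (A *v (x - y)) (x - y)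
     + \<i> * (cdot (A *v (x + \<i> *s y)) (x + \<i> *s y) - cdot (A *v (x - \<i> *s y)) (x - \<i> *s y))"
  by (simp add: matrix_vector_right_distrib matrix_vector_mult_diff_distrib cdot_simps
      vector_scalar_commute algebra_simps)

text \<open>Polarization writes the sesquilinear form as a fixed combination of four quadratic
  values. It bridges the gap to \<open>has_mat_integral\<close>, which speaks of quadratic forms
  only.\<close>

lemma tendsto_cdot_of_quad:
  assumes "\<And>x. ((\<lambda>k. c k * cdot (A k *v x) x) \<longlongrightarrow> cdot (L *v x) x) F"
  shows "((\<lambda>k. c k * cdot (A k *v x) y) \<longlongrightarrow> cdot (L *v x) y) F"
proof -
  let ?q = "\<lambda>B u. cdot (B *v u) u"
  have "((\<lambda>k. (c k * ?q (A k) (x + y) - c k * ?q (A k) (x - y)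
      + \<i> * (c k * ?q (A k) (x + \<i> *s y) - c k * ?q (A k) (x - \<i> *s y))) / 4) \<longlongrightarrow>
    (?q L (x + y) - ?q L (x - y) + \<i> * (?q L (x + \<i> *s y) - ?q L (x - \<i> *s y))) / 4) F"
    by (intro tendsto_intros assms) simp
  then have "((\<lambda>k. c k * (4 * cdot (A k *v x) y) / 4) \<longlongrightarrow> (4 * cdot (L *v x) y) / 4) F"
    unfolding polarization by (simp add: algebra_simps)
  then show ?thesis by simp
qed

lemma tendsto_mat_vec_of_quad:
  assumes "\<And>x. ((\<lambda>k. c k * cdot (A k *v x) x) \<longlongrightarrow> cdot (L *v x) x) F"
  shows "((\<lambda>k. c k *s (A k *v x)) \<longlongrightarrow> L *v x) F"
proof (rule vec_tendstoI)
  fix i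
  show "((\<lambda>k. (c k *s (A k *v x)) $ i) \<longlongrightarrow> (L *v x) $ i) F"
    using tendsto_cdot_of_quad[OF assms, of x "axis i 1"] by (simp add: cdot_axis)
qed

text \<open>Expand the nonnegative form at a combination of \<open>v\<close> and \<open>x\<close>,
  then divide by \<open>w\<close>. Unlike the product form of Cauchy--Schwarz, this version is
  additive in \<open>A\<close>, so it can be summed over the cells of a partition with varying
  \<open>w\<close>.\<close>

lemma nonneg_mat_cauchy_schwarz:
  assumes "nonneg_mat A" and "w > 0"
  shows "2 * Re (p * cdot (A *v v) x)
    \<le> w * Re (cdot (A *v v) v) + (norm p)\<^sup>2 / w * Re (cdot (A *v x) x)"
proof -
  \<comment> \<open>The conjugate on \<open>p\<close> cancels against the conjugate-linear second
    slot and leaves the cross term \<open>p * cdot (A *v v) x\<close>.\<close>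
  define u where "u = complex_of_real w *s v - cnj p *s x"
  have sa: "cdot (A *v x) v = cnj (cdot (A *v v) x)"
    using nonneg_mat_self_adjoint[OF assms(1)] by (metis cdot_vec_mat cnj_cdot)
  have "cdot (A *v u) u = complex_of_real (w\<^sup>2) * cdot (A *v v) v - w * (p * cdot (A *v v) x)
      - w * cnj (p * cdot (A *v v) x) + complex_of_real ((norm p)\<^sup>2) * cdot (A *v x) x"
    unfolding u_def complex_norm_square
    by (simp add: matrix_vector_mult_diff_distrib cdot_simps vector_scalar_commute sa
        complex_norm_square algebra_simps power2_eq_square[of "complex_of_real w"])
  from arg_cong[OF this, of Re] have "Re (cdot (A *v u) u) = w\<^sup>2 * Re (cdot (A *v v) v)
      - 2 * w * Re (p * cdot (A *v v) x) + (norm p)\<^sup>2 * Re (cdot (A *v x) x)"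
    by (simp add: algebra_simps flip: of_real_power)
  moreover have "Re (cdot (A *v u) u) \<ge> 0"
    using assms(1) by (simp add: nonneg_mat_def complex_nonneg_Reals_iff)
  ultimately have "w * (2 * Re (p * cdot (A *v v) x))
      \<le> w * (w * Re (cdot (A *v v) v) + (norm p)\<^sup>2 / w * Re (cdot (A *v x) x))"
    using assms(2) by (simp add: algebra_simps power2_eq_square)
  then show ?thesis
    using assms(2) by (simp only: mult_le_cancel_left_pos)
qed

section \<open>Integration against a matrix-valued measure\<close>

text \<open>On the space, the integrand is a finite combination of indicators of level sets of
  \<open>h\<close>. With \<open>h\<close> taking values in pairs, several integrals share one
  partition.\<close>

lemma has_bochner_integral_simple_comp:
  fixes g :: "'b \<Rightarrow> 'c :: {banach, second_countable_topology}"
  assumes "finite_measure M" and "simple_function M h"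
  shows "has_bochner_integral M (\<lambda>x. g (h x))
    (\<Sum>r\<in>h ` space M. measure M (h -` {r} \<inter> space M) *\<^sub>R g r)"
proof -
  interpret finite_measure M by fact
  have fin: "finite (h ` space M)" and meas: "\<And>r. h -` {r} \<inter> space M \<in> sets M"
    using simple_functionD[OF assms(2)] by auto
  have "has_bochner_integral M
      (\<lambda>x. \<Sum>r\<in>h ` space M. indicator (h -` {r} \<inter> space M) x *\<^sub>R g r)
      (\<Sum>r\<in>h ` space M. measure M (h -` {r} \<inter> space M) *\<^sub>R g r)"
    by (intro has_bochner_integral_sum has_bochner_integral_indicator meas)
      (simp add: emeasure_eq_measure)
  moreover have "(\<Sum>r\<in>h ` space M. indicator (h -` {r} \<inter> space M) x *\<^sub>R g r) = g (h x)"
    if "x \<in> space M" for x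
  proof -
    have "(\<Sum>r\<in>h ` space M. indicator (h -` {r} \<inter> space M) x *\<^sub>R g r)
        = (\<Sum>r\<in>h ` space M. if r = h x then g r else 0)"
      using that by (intro sum.cong) (auto simp: indicator_def)
    then show ?thesis
      using that fin by (simp add: sum.delta)
  qed
  ultimately show ?thesis
    using has_bochner_integral_cong by force
qed

section \<open>The scalar measures of a matrix-valued measure\<close>

lemma measure_quad_measure:
  assumes "nonneg_mat_measure \<mu>" and "A \<in> sets circle_borel"
  shows "measure (quad_measure \<mu> x) A = Re (cdot (\<mu> A *v x) x)"
proof -
  have "Re (cdot (\<mu> A *v x) x) \<ge> 0"
    using assms unfolding nonneg_mat_measure_def nonneg_mat_def
    by (metis complex_nonneg_Reals_iff)
  then show ?thesis
    by (simp add: measure_def emeasure_quad_measure[OF assms])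
qed

lemma cdot_eq_measure_quad_measure:
  assumes "nonneg_mat_measure \<mu>" and "A \<in> sets circle_borel"
  shows "cdot (\<mu> A *v x) x = complex_of_real (measure (quad_measure \<mu> x) A)"
proof -
  have "Im (cdot (\<mu> A *v x) x) = 0"
    using assms unfolding nonneg_mat_measure_def nonneg_mat_def
    by (metis complex_nonneg_Reals_iff)
  then show ?thesis
    by (simp add: measure_quad_measure[OF assms] complex_eq_iff)
qed

lemma sphere_in_circle_borel: "sphere 0 1 \<in> sets circle_borel"
  using sets.top[of circle_borel] by (simp add: space_restrict_space)

lemma finite_measure_quad_measure:
  assumes "nonneg_mat_measure \<mu>"
  shows "finite_measure (quad_measure \<mu> x)"
  by (rule finite_measureI)
    (simp add: emeasure_quad_measure[OF assms sphere_in_circle_borel])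

lemma cdot_sum_mat:
  assumes "finite R"
  shows "cdot ((\<Sum>r\<in>R. mat (p r) ** A r) *v x) y = (\<Sum>r\<in>R. p r * cdot (A r *v x) y)"
  using assms
proof (induction R rule: finite_induct)
  case empty
  then show ?case by (simp add: cdot_def)
next
  case (insert r R)
  then show ?case
    by (simp add: matrix_vector_mult_add_rdistrib cdot_simps mat_vec
        flip: matrix_vector_mul_assoc)
qed

text \<open>For simple \<open>f\<close> this is the Cauchy--Schwarz inequality for each value of \<open>\<mu>\<close> on the level sets
  of \<open>(f, w)\<close>; the general case follows by dominated convergence.\<close>

lemma mat_integral_weighted_cauchy_schwarz:
  fixes w :: "complex \<Rightarrow> real"
  assumes \<mu>: "nonneg_mat_measure \<mu>" and J: "has_mat_integral \<mu> f J"
    and w: "simple_function circle_borel w" and w_pos: "\<And>\<zeta>. \<zeta> \<in> sphere 0 1 \<Longrightarrow> w \<zeta> > 0"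
    and int: "integrable (quad_measure \<mu> x) (\<lambda>\<zeta>. (norm (f \<zeta>))\<^sup>2 / w \<zeta>)"
  shows "2 * Re (cdot (J *v v) x)
    \<le> (LINT \<zeta>|quad_measure \<mu> v. w \<zeta>) + (LINT \<zeta>|quad_measure \<mu> x. (norm (f \<zeta>))\<^sup>2 / w \<zeta>)"
proof -
  let ?Q = "quad_measure \<mu>"
  have space: "space circle_borel = sphere 0 1"
    by (simp add: space_restrict_space)
  have f_int: "integrable (?Q y) f" for y
    using J by (simp add: has_mat_integral_def)
  have meas: "borel_measurable (?Q y) = borel_measurable circle_borel" for y
    by (rule measurable_cong_sets) simp_all
  have simple: "simple_function (?Q y) h = simple_function circle_borel h"
    for y and h :: "complex \<Rightarrow> 'z"
    by (simp add: simple_function_def space)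
  have f_meas: "f \<in> borel_measurable circle_borel"
    using borel_measurable_integrable[OF f_int] by (simp add: meas)
  \<comment> \<open>The reference point 0 turns the metric bound on the approximating sequence into
    domination by \<open>2 * norm (f \<zeta>)\<close>.\<close>
  obtain F where F: "\<And>i. simple_function circle_borel (F i)"
      "\<And>\<zeta>. \<zeta> \<in> sphere 0 1 \<Longrightarrow> (\<lambda>i. F i \<zeta>) \<longlonglongrightarrow> f \<zeta>"
      "\<And>i \<zeta>. \<zeta> \<in> sphere 0 1 \<Longrightarrow> norm (F i \<zeta>) \<le> 2 * norm (f \<zeta>)"
    using borel_measurable_implies_sequence_metric[OF f_meas, of 0] unfolding space by force
  have F_meas: "F i \<in> borel_measurable circle_borel" for i
    using F(1) by (rule borel_measurable_simple_function)
  have w_meas: "w \<in> borel_measurable circle_borel"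
    using w by (rule borel_measurable_simple_function)
  define h where "h i \<zeta> = (F i \<zeta>, w \<zeta>)" for i \<zeta>
  define R where "R i = h i ` sphere 0 1" for i
  define A where "A i r = h i -` {r} \<inter> sphere 0 1" for i r
  have h: "simple_function circle_borel (h i)" for i
    unfolding h_def using F(1) w by (rule simple_function_Pair)
  have R: "finite (R i)" for i
    using simple_functionD(1)[OF h] by (simp add: R_def space)
  have A: "A i r \<in> sets circle_borel" for i r
    using simple_functionD(2)[OF h, of i "{r}"] by (simp add: A_def space)
  have simple_int: "(LINT \<zeta>|?Q y. g (h i \<zeta>)) = (\<Sum>r\<in>R i. measure (?Q y) (A i r) *\<^sub>R g r)"
    for y i and g :: "complex \<times> real \<Rightarrow> 'c :: {banach, second_countable_topology}"
    using has_bochner_integral_simple_comp[OF finite_measure_quad_measure[OF \<mu>], of y "h i" g] h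
    by (auto simp: simple R_def A_def dest: has_bochner_integral_integral_eq)
  \<comment> \<open>\<open>K i\<close> is the integral of the simple function \<open>F i\<close>,
    whose value on the cell of the pair \<open>r\<close> is \<open>fst r\<close>; the weight there
    is \<open>snd r\<close>.\<close>
  define K where "K i = (\<Sum>r\<in>R i. mat (fst r) ** \<mu> (A i r))" for i
  have K: "cdot (K i *v y) z = (\<Sum>r\<in>R i. fst r * cdot (\<mu> (A i r) *v y) z)" for i y z
    unfolding K_def by (rule cdot_sum_mat[OF R])
  have "(\<lambda>i. cdot (K i *v y) y) \<longlonglongrightarrow> cdot (J *v y) y" for y
  proof -
    have "(LINT \<zeta>|?Q y. F i \<zeta>) = cdot (K i *v y) y" for i
      using simple_int[of y fst i]
      by (simp add: K h_def cdot_eq_measure_quad_measure[OF \<mu> A] scaleR_conv_of_real mult.commute)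
    moreover have "(\<lambda>i. LINT \<zeta>|?Q y. F i \<zeta>) \<longlonglongrightarrow> (LINT \<zeta>|?Q y. f \<zeta>)"
      by (rule integral_dominated_convergence[where w = "\<lambda>\<zeta>. 2 * norm (f \<zeta>)"])
        (use F f_int F_meas f_meas in \<open>auto simp: meas\<close>)
    ultimately show ?thesis
      using J by (simp add: has_mat_integral_def)
  qed
  then have "(\<lambda>i. cdot (K i *v v) x) \<longlonglongrightarrow> cdot (J *v v) x"
    using tendsto_cdot_of_quad[where c = "\<lambda>_. 1" and A = K and L = J] by simp
  then have lhs: "(\<lambda>i. 2 * Re (cdot (K i *v v) x)) \<longlonglongrightarrow> 2 * Re (cdot (J *v v) x)"
    by (intro tendsto_intros)
  \<comment> \<open>The factor 4 in the dominating function is the square of the 2 in the bound on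
    \<open>F i\<close>.\<close>
  have "(\<lambda>i. LINT \<zeta>|?Q x. (norm (F i \<zeta>))\<^sup>2 / w \<zeta>) \<longlonglongrightarrow> (LINT \<zeta>|?Q x. (norm (f \<zeta>))\<^sup>2 / w \<zeta>)"
  proof (rule integral_dominated_convergence[where w = "\<lambda>\<zeta>. 4 * ((norm (f \<zeta>))\<^sup>2 / w \<zeta>)"])
    show "AE \<zeta> in ?Q x. (\<lambda>i. (norm (F i \<zeta>))\<^sup>2 / w \<zeta>) \<longlonglongrightarrow> (norm (f \<zeta>))\<^sup>2 / w \<zeta>"
      using F(2) by (auto intro!: tendsto_intros simp: less_imp_neq[OF w_pos, symmetric])
    have "(norm (F i \<zeta>))\<^sup>2 \<le> 4 * (norm (f \<zeta>))\<^sup>2" if "\<zeta> \<in> sphere 0 1" for i \<zeta>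
      using power_mono[OF F(3)[OF that], of i 2] by (simp add: power_mult_distrib)
    then show "AE \<zeta> in ?Q x. norm ((norm (F i \<zeta>))\<^sup>2 / w \<zeta>) \<le> 4 * ((norm (f \<zeta>))\<^sup>2 / w \<zeta>)" for i
      using w_pos by (intro AE_I2) (simp add: divide_right_mono less_imp_le)
    show "integrable (?Q x) (\<lambda>\<zeta>. 4 * ((norm (f \<zeta>))\<^sup>2 / w \<zeta>))"
      using int by (rule integrable_mult_right)
  qed (use F_meas f_meas w_meas in \<open>auto simp: meas\<close>)
  then have rhs: "(\<lambda>i. (LINT \<zeta>|?Q v. w \<zeta>) + (LINT \<zeta>|?Q x. (norm (F i \<zeta>))\<^sup>2 / w \<zeta>))
      \<longlonglongrightarrow> (LINT \<zeta>|?Q v. w \<zeta>) + (LINT \<zeta>|?Q x. (norm (f \<zeta>))\<^sup>2 / w \<zeta>)"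
    by (intro tendsto_intros)
  have "2 * Re (cdot (K i *v v) x)
      \<le> (LINT \<zeta>|?Q v. w \<zeta>) + (LINT \<zeta>|?Q x. (norm (F i \<zeta>))\<^sup>2 / w \<zeta>)" for i
  proof -
    have "2 * Re (cdot (K i *v v) x) = (\<Sum>r\<in>R i. 2 * Re (fst r * cdot (\<mu> (A i r) *v v) x))"
      by (simp add: K sum_distrib_left)
    also have "\<dots> \<le> (\<Sum>r\<in>R i. snd r * measure (?Q v) (A i r)
        + (norm (fst r))\<^sup>2 / snd r * measure (?Q x) (A i r))"
    proof (rule sum_mono)
      fix r assume "r \<in> R i"
      then have "snd r > 0"
        using w_pos by (auto simp: R_def h_def)
      moreover have "nonneg_mat (\<mu> (A i r))"
        using \<mu> A by (simp add: nonneg_mat_measure_def)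
      ultimately show "2 * Re (fst r * cdot (\<mu> (A i r) *v v) x)
          \<le> snd r * measure (?Q v) (A i r) + (norm (fst r))\<^sup>2 / snd r * measure (?Q x) (A i r)"
        using nonneg_mat_cauchy_schwarz by (simp add: measure_quad_measure[OF \<mu> A])
    qed
    also have "\<dots> = (LINT \<zeta>|?Q v. w \<zeta>) + (LINT \<zeta>|?Q x. (norm (F i \<zeta>))\<^sup>2 / w \<zeta>)"
      using simple_int[of v snd i] simple_int[of x "\<lambda>r. (norm (fst r))\<^sup>2 / snd r" i]
      by (simp add: h_def sum.distrib mult.commute)
    finally show ?thesis .
  qed
  then show ?thesis
    using LIMSEQ_le[OF lhs rhs] by blast
qed

section \<open>The resolvent of a Schur function\<close>

text \<open>This is the Poisson kernel: multiplied by the conjugate denominator, the numerator has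
  real part |\<zeta>|^2 - |z|^2.\<close>

lemma Re_poisson_kernel:
  assumes "\<zeta> \<noteq> z" and "norm \<zeta> = 1"
  shows "Re ((\<zeta> + z) / (\<zeta> - z)) = (1 - (norm z)\<^sup>2) / (norm (\<zeta> - z))\<^sup>2"
proof -
  have "(\<zeta> + z) / (\<zeta> - z) = (\<zeta> + z) * cnj (\<zeta> - z) / complex_of_real ((norm (\<zeta> - z))\<^sup>2)"
    unfolding complex_norm_square using assms(1) by (simp add: divide_simps del: complex_cnj_diff)
  then have "Re ((\<zeta> + z) / (\<zeta> - z)) = Re ((\<zeta> + z) * cnj (\<zeta> - z)) / (norm (\<zeta> - z))\<^sup>2"
    by (simp only: Re_divide_of_real)
  also have "Re ((\<zeta> + z) * cnj (\<zeta> - z)) = (norm \<zeta>)\<^sup>2 - (norm z)\<^sup>2"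
    unfolding cmod_power2 by (simp add: algebra_simps power2_eq_square)
  finally show ?thesis
    using assms(2) by simp
qed

lemma unitary_norm_cadj:
  assumes "unitary \<alpha>"
  shows "norm (cadj \<alpha> *v x) = norm x" and "norm (\<alpha> *v x) = norm x"
proof -
  have "cdot (cadj \<alpha> *v x) (cadj \<alpha> *v x) = cdot x x"
    using assms by (simp add: cdot_mat_vec matrix_vector_mul_assoc unitary_def)
  then show "norm (cadj \<alpha> *v x) = norm x"
    unfolding cdot_self by (simp only: of_real_eq_iff) simp
  have "cdot (\<alpha> *v x) (\<alpha> *v x) = cdot x x"
    using assms by (simp add: cdot_mat_vec matrix_vector_mul_assoc unitary_def)
  then show "norm (\<alpha> *v x) = norm x"
    unfolding cdot_self by (simp only: of_real_eq_iff) simp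
qed

section \<open>Resolvent identities for the twisted Schur function\<close>

locale clark =
  fixes b :: "complex \<Rightarrow> complex ^ 'n ^ 'n"
    and \<alpha> :: "complex ^ 'n ^ 'n"
    and \<mu> :: "complex set \<Rightarrow> complex ^ 'n ^ 'n"
    and l :: complex
  assumes schur: "schur_class b"
    and unitary: "unitary \<alpha>"
    and l: "norm l = 1"
    and AC: "AC_measure b \<alpha> \<mu>"
begin

definition B :: "complex \<Rightarrow> complex ^ 'n ^ 'n" where
  "B z = b z ** cadj \<alpha>"

definition G :: "complex \<Rightarrow> complex ^ 'n ^ 'n" where
  "G z = matrix_inv (mat 1 - B z)"

definition defect :: "complex ^ 'n \<Rightarrow> complex \<Rightarrow> complex ^ 'n" where
  "defect e z = e - cadj (B z) *v e"

lemma nonneg: "nonneg_mat_measure \<mu>"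
  using AC by (simp add: AC_measure_def)

lemma cadj_B: "cadj (B z) *v e = \<alpha> *v (cadj (b z) *v e)"
  by (simp add: B_def cadj_mult matrix_vector_mul_assoc)

lemma norm_cadj_B: "norm (cadj (B z) *v e) = norm (cadj (b z) *v e)"
  by (simp add: cadj_B unitary_norm_cadj[OF unitary])

text \<open>The isometry \<open>cadj \<alpha>\<close> carries the defect to
  \<open>cadj \<alpha> *v e - cadj (b z) *v e\<close>. Hence the limit in \<open>S_set\<close> says
  that the defect tends to zero.\<close>

lemma norm_defect: "norm (defect e z) = norm (cadj (b z) *v e - cadj \<alpha> *v e)"
proof -
  have "cadj \<alpha> *v defect e z = cadj \<alpha> *v e - cadj (b z) *v e"
    using unitary
    by (simp add: defect_def cadj_B matrix_vector_mult_diff_distrib matrix_vector_mul_assoc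
        unitary_def matrix_mul_assoc)
  then show ?thesis
    by (metis unitary_norm_cadj(1)[OF unitary] norm_minus_commute)
qed

lemma norm_B_le:
  assumes "z \<in> ball 0 1"
  shows "norm (B z *v x) \<le> onorm ((*v) (b z)) * norm x"
  using onorm[OF matrix_vector_mul_bounded_linear, of "b z" "cadj \<alpha> *v x"]
  by (simp add: B_def unitary_norm_cadj[OF unitary] flip: matrix_vector_mul_assoc)

text \<open>\<open>B z\<close> has operator norm below 1, so \<open>mat 1 - B z\<close> has trivial
  kernel and, being square, is invertible.\<close>

lemma G_inverse:
  assumes "z \<in> ball 0 1"
  shows "(mat 1 - B z) ** G z = mat 1" "G z ** (mat 1 - B z) = mat 1"
proof -
  have "x = 0" if "(mat 1 - B z) *v x = 0" for x
  proof (rule ccontr)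
    assume "x \<noteq> 0"
    have "B z *v x = x"
      using that by (simp add: matrix_vector_mult_diff_rdistrib)
    then have "norm x \<le> onorm ((*v) (b z)) * norm x"
      using norm_B_le[OF assms, of x] by simp
    then show False
      using \<open>x \<noteq> 0\<close> schur assms by (simp add: schur_class_def not_le[symmetric])
  qed
  then have "invertible (mat 1 - B z)"
    unfolding invertible_left_inverse using matrix_left_invertible_ker by blast
  then have "(mat 1 - B z) ** G z = mat 1 \<and> G z ** (mat 1 - B z) = mat 1"
    unfolding G_def matrix_inv_def invertible_def by (rule someI_ex)
  then show "(mat 1 - B z) ** G z = mat 1" "G z ** (mat 1 - B z) = mat 1"
    by simp_all
qed

text \<open>The adjoint of a contraction is a contraction: for the image y of x, |y|^2 = <x, B y>
  \<le> |x| |y|.\<close>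

lemma norm_cadj_B_le:
  assumes "z \<in> ball 0 1"
  shows "norm (cadj (B z) *v x) \<le> norm x"
proof -
  let ?y = "cadj (B z) *v x"
  have "(norm ?y)\<^sup>2 = x \<bullet> (B z *v ?y)"
    by (simp add: power2_norm_eq_inner inner_eq_Re_cdot cdot_vec_mat)
  also have "\<dots> \<le> norm x * norm (B z *v ?y)"
    by (rule norm_cauchy_schwarz)
  also have "\<dots> \<le> norm x * norm ?y"
    using norm_B_le[OF assms, of ?y] schur assms
    by (intro mult_left_mono order_trans[OF norm_B_le[OF assms]] mult_left_le_one_le)
      (auto simp: schur_class_def less_imp_le intro: onorm_pos_le)
  finally show ?thesis
    by (metis mult_right_le_imp_le norm_ge_zero norm_le_zero_iff not_le order_refl power2_eq_square
        order.trans)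
qed

text \<open>The defect map is the adjoint of \<open>mat 1 - B z\<close>, so its inverse is
  \<open>cadj (G z)\<close>.\<close>

lemma cadj_G_defect:
  assumes "z \<in> ball 0 1"
  shows "cadj (G z) *v defect e z = e" and "defect (cadj (G z) *v x) z = x"
proof -
  have 1: "defect u z = cadj (mat 1 - B z) *v u" for u
    by (simp add: defect_def cadj_diff matrix_vector_mult_diff_rdistrib)
  show "cadj (G z) *v defect e z = e" "defect (cadj (G z) *v x) z = x"
    unfolding 1 matrix_vector_mul_assoc cadj_mult[symmetric] G_inverse[OF assms] by simp_all
qed

text \<open>From (I - B) G = I follows B G = G - I, while H = G + B G.\<close>

lemma H_eq_G:
  assumes "z \<in> ball 0 1"
  shows "H_fun b \<alpha> z *v x = 2 *s (G z *v x) - x"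
proof -
  have "G z *v x - B z *v (G z *v x) = (mat 1 - B z) *v (G z *v x)"
    by (simp add: matrix_vector_mult_diff_rdistrib)
  also have "\<dots> = x"
    by (simp add: matrix_vector_mul_assoc G_inverse[OF assms])
  finally have "B z *v (G z *v x) = G z *v x - x"
    by (simp add: algebra_simps)
  moreover have "H_fun b \<alpha> z *v x = G z *v x + B z *v (G z *v x)"
    by (simp add: H_fun_def matrix_vector_mult_add_rdistrib flip: B_def G_def matrix_vector_mul_assoc)
  ultimately show ?thesis
    by (simp add: vec_eq_iff)
qed

text \<open>For the defect d, moving G to the other side gives <G d, d> = <d, e>. So the value is 2
  Re <d, e> - |d|^2, a difference of squares because e - d is the image of e under the adjoint of
  B.\<close>

lemma quad_G_defect:
  assumes "z \<in> ball 0 1"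
  shows "Re (cdot (H_fun b \<alpha> z *v defect e z) (defect e z)) = (norm e)\<^sup>2 - (norm (cadj (b z) *v e))\<^sup>2"
proof -
  let ?x = "defect e z"
  have "cdot (H_fun b \<alpha> z *v ?x) ?x = 2 * cdot ?x e - cdot ?x ?x"
    by (simp add: H_eq_G[OF assms] cdot_simps cdot_mat_vec cadj_G_defect[OF assms])
  then have "Re (cdot (H_fun b \<alpha> z *v ?x) ?x) = 2 * (?x \<bullet> e) - ?x \<bullet> ?x"
    by (simp add: inner_eq_Re_cdot)
  also have "\<dots> = (norm e)\<^sup>2 - (norm (cadj (B z) *v e))\<^sup>2"
    by (simp add: defect_def power2_norm_eq_inner inner_simps inner_commute)
  finally show ?thesis
    by (simp add: norm_cadj_B)
qed

text \<open>The two sides differ by the squared norm of the defect.\<close>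

lemma defect_le:
  "(norm e)\<^sup>2 - (norm (cadj (b z) *v e))\<^sup>2 \<le> 2 * Re (cdot e (defect e z))"
proof -
  have "0 \<le> (norm (defect e z))\<^sup>2"
    by simp
  then show ?thesis
    unfolding norm_cadj_B[symmetric]
    by (simp add: defect_def power2_norm_eq_inner inner_simps inner_commute flip: inner_eq_Re_cdot)
qed

section \<open>The Herglotz representation at defect vectors\<close>

lemma herglotz:
  assumes "z \<in> ball 0 1"
  obtains J where "has_mat_integral \<mu> (\<lambda>\<zeta>. (\<zeta> + z) / (\<zeta> - z)) J"
    and "\<And>x. H_fun b \<alpha> z *v x = \<i> *s (Im_mat (H_fun b \<alpha> 0) *v x) + J *v x"
proof -
  obtain J where "has_mat_integral \<mu> (\<lambda>\<zeta>. (\<zeta> + z) / (\<zeta> - z)) J"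
    and "H_fun b \<alpha> z = mat \<i> ** Im_mat (H_fun b \<alpha> 0) + J"
    using AC assms unfolding AC_measure_def by blast
  then show ?thesis
    using that by (simp add: matrix_vector_mult_add_rdistrib mat_vec flip: matrix_vector_mul_assoc)
qed

text \<open>The constant of the Herglotz representation is \<i> times a self-adjoint matrix and
  drops out of the real part. What remains is a Poisson integral, whose value is given by
  \<open>quad_G_defect\<close>.\<close>

lemma poisson_integral_defect:
  assumes z: "z \<in> ball 0 1"
  shows "has_bochner_integral (quad_measure \<mu> (defect e z)) (\<lambda>\<zeta>. 1 / (norm (\<zeta> - z))\<^sup>2)
    (((norm e)\<^sup>2 - (norm (cadj (b z) *v e))\<^sup>2) / (1 - (norm z)\<^sup>2))"
proof -
  let ?x = "defect e z" and ?k = "\<lambda>\<zeta>. (\<zeta> + z) / (\<zeta> - z)"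
  let ?Q = "quad_measure \<mu> ?x" and ?A = "Im_mat (H_fun b \<alpha> 0)"
  obtain J where J: "has_mat_integral \<mu> ?k J"
    and H: "\<And>x. H_fun b \<alpha> z *v x = \<i> *s (?A *v x) + J *v x"
    using herglotz[OF z] by metis
  have "Im (cdot (?A *v ?x) ?x) = 0"
    by (metis Im_mat_self_adjoint cdot_vec_mat cnj_cdot Reals_cnj_iff complex_is_Real_iff)
  then have "Re (cdot (J *v ?x) ?x) = (norm e)\<^sup>2 - (norm (cadj (b z) *v e))\<^sup>2"
    using quad_G_defect[OF z, of e] by (simp add: H cdot_simps)
  moreover have k: "integrable ?Q ?k" "cdot (J *v ?x) ?x = (LINT \<zeta>|?Q. ?k \<zeta>)"
    using J by (auto simp: has_mat_integral_def)
  ultimately have "has_bochner_integral ?Q (\<lambda>\<zeta>. Re (?k \<zeta>))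
      ((norm e)\<^sup>2 - (norm (cadj (b z) *v e))\<^sup>2)"
    by (metis has_bochner_integral_Re has_bochner_integral_integrable)
  then have "has_bochner_integral ?Q (\<lambda>\<zeta>. Re (?k \<zeta>) / (1 - (norm z)\<^sup>2))
      (((norm e)\<^sup>2 - (norm (cadj (b z) *v e))\<^sup>2) / (1 - (norm z)\<^sup>2))"
    by (rule has_bochner_integral_divide_zero)
  moreover have "Re (?k \<zeta>) / (1 - (norm z)\<^sup>2) = 1 / (norm (\<zeta> - z))\<^sup>2" if "\<zeta> \<in> space ?Q" for \<zeta>
  proof -
    have "norm \<zeta> = 1" "\<zeta> \<noteq> z" "(norm z)\<^sup>2 < 1"
      using that z by (auto simp: power_less_one_iff)
    then show ?thesis
      by (simp add: Re_poisson_kernel)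
  qed
  ultimately show ?thesis
    using has_bochner_integral_cong by (metis (no_types, lifting))
qed

section \<open>The point mass as a non-tangential limit\<close>

lemma singleton_in_circle_borel: "{l} \<in> sets circle_borel"
  using l by (auto simp: sets_restrict_space_iff)

lemma norm_diff_l: "norm (1 - cnj l * z) = norm (l - z)"
proof -
  have "1 - cnj l * z = cnj l * (l - z)"
    using l complex_norm_square[of l] by (simp add: algebra_simps)
  then show ?thesis
    using l by (simp add: norm_mult)
qed

text \<open>Multiplied by \<open>1 - cnj l * z\<close>, the Herglotz kernel tends to 2 at
  \<open>l\<close> and to 0 elsewhere on the circle, and it stays bounded on a Stolz region.
  Dominated convergence isolates the point mass; the 2 cancels against that of H + I = 2 G.\<close>

lemma tendsto_quad_G:
  assumes t: "t > 1" and Z: "\<And>k. Z k \<in> stolz t l" and lim: "Z \<longlonglongrightarrow> l"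
  shows "(\<lambda>k. (1 - cnj l * Z k) * cdot (G (Z k) *v x) x) \<longlonglongrightarrow> cdot (\<mu> {l} *v x) x"
proof -
  let ?Q = "quad_measure \<mu> x" and ?c = "\<lambda>k. 1 - cnj l * Z k"
  let ?f = "\<lambda>k \<zeta>. (\<zeta> + Z k) / (\<zeta> - Z k)"
  \<comment> \<open>\<open>K\<close> collects the terms of 2 <G x, x> that do not depend on
    \<open>k\<close>; the factor \<open>?c k\<close> removes them in the limit.\<close>
  define K where "K = cdot (\<i> *s (Im_mat (H_fun b \<alpha> 0) *v x)) x + cdot x x"
  interpret finite_measure ?Q
    by (rule finite_measure_quad_measure[OF nonneg])
  have ball: "Z k \<in> ball 0 1" for k
    using Z[of k] by (simp add: stolz_def)
  have f: "integrable ?Q (?f k)" and G: "2 * cdot (G (Z k) *v x) x = K + (LINT \<zeta>|?Q. ?f k \<zeta>)" for k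
  proof -
    obtain J where J: "has_mat_integral \<mu> (?f k) J"
      and H: "\<And>x. H_fun b \<alpha> (Z k) *v x = \<i> *s (Im_mat (H_fun b \<alpha> 0) *v x) + J *v x"
      using herglotz[OF ball] by metis
    show "integrable ?Q (?f k)"
      using J by (simp add: has_mat_integral_def)
    have "2 * cdot (G (Z k) *v x) x = cdot (H_fun b \<alpha> (Z k) *v x) x + cdot x x"
      by (simp add: H_eq_G[OF ball] cdot_simps)
    then show "2 * cdot (G (Z k) *v x) x = K + (LINT \<zeta>|?Q. ?f k \<zeta>)"
      using J by (simp add: H K_def cdot_simps has_mat_integral_def)
  qed
  have c: "?c \<longlonglongrightarrow> 0"
    using lim l complex_norm_square[of l] by (auto intro!: tendsto_eq_intros simp: mult.commute)
  have "(\<lambda>k. LINT \<zeta>|?Q. ?c k * ?f k \<zeta>) \<longlonglongrightarrow> (LINT \<zeta>|?Q. indicator {l} \<zeta> *\<^sub>R (2 :: complex))"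
  proof (rule integral_dominated_convergence[where w = "\<lambda>_. 2 * t"])
    show "(\<lambda>\<zeta>. indicator {l} \<zeta> *\<^sub>R (2 :: complex)) \<in> borel_measurable ?Q"
      using singleton_in_circle_borel by (intro borel_measurable_scaleR borel_measurable_indicator) auto
    show "(\<lambda>\<zeta>. ?c k * ?f k \<zeta>) \<in> borel_measurable ?Q" for k
      using borel_measurable_integrable[OF f] by (intro borel_measurable_times) auto
    show "AE \<zeta> in ?Q. (\<lambda>k. ?c k * ?f k \<zeta>) \<longlonglongrightarrow> indicator {l} \<zeta> *\<^sub>R (2 :: complex)"
    proof (rule AE_I2)
      fix \<zeta> assume "\<zeta> \<in> space ?Q"
      show "(\<lambda>k. ?c k * ?f k \<zeta>) \<longlonglongrightarrow> indicator {l} \<zeta> *\<^sub>R (2 :: complex)"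
      proof (cases "\<zeta> = l")
        case True
        \<comment> \<open>At \<open>l\<close> the factor \<open>?c k\<close> cancels the denominator
          of the kernel.\<close>
        have "?c k * ?f k \<zeta> = cnj l * (l + Z k)" for k
        proof -
          have "?c k = cnj l * (l - Z k)"
            using l complex_norm_square[of l] by (simp add: algebra_simps)
          moreover have "Z k \<noteq> l"
            using ball[of k] l by auto
          ultimately show ?thesis
            using True by simp
        qed
        moreover have "(\<lambda>k. cnj l * (l + Z k)) \<longlonglongrightarrow> 2"
          using lim l complex_norm_square[of l]
          by (auto intro!: tendsto_eq_intros simp: mult.commute algebra_simps)
        ultimately show ?thesis
          using True by simp
      next
        case False
        have "(\<lambda>k. ?c k * ?f k \<zeta>) \<longlonglongrightarrow> 0 * ((\<zeta> + l) / (\<zeta> - l))"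
          using False by (intro tendsto_intros c lim) simp
        then show ?thesis
          using False by simp
      qed
    qed
    \<comment> \<open>In the Stolz region the norm of \<open>?c k\<close> is below t (1 - |Z k|)
      \<le> t |\<zeta> - Z k|, which cancels the denominator; the numerator is at most 2.\<close>
    show "AE \<zeta> in ?Q. norm (?c k * ?f k \<zeta>) \<le> 2 * t" for k
    proof (rule AE_I2)
      fix \<zeta> assume "\<zeta> \<in> space ?Q"
      then have \<zeta>: "norm \<zeta> = 1" by simp
      have "1 - norm (Z k) \<le> norm (\<zeta> - Z k)"
        using \<zeta> by (metis norm_triangle_ineq2)
      then have "t * (1 - norm (Z k)) \<le> t * norm (\<zeta> - Z k)"
        using t by simp
      moreover have "norm (?c k) < t * (1 - norm (Z k))"
        using Z[of k] by (simp add: norm_diff_l stolz_def norm_minus_commute)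
      ultimately have 1: "norm (?c k) \<le> t * norm (\<zeta> - Z k)"
        by simp
      have 2: "norm (\<zeta> + Z k) \<le> 2"
        using norm_triangle_ineq[of \<zeta> "Z k"] \<zeta> ball[of k] by simp
      have pos: "norm (\<zeta> - Z k) > 0"
        using \<zeta> ball[of k] by auto
      have "norm (?c k) * norm (\<zeta> + Z k) \<le> t * norm (\<zeta> - Z k) * 2"
        using t by (intro mult_mono 1 2) auto
      then show "norm (?c k * ?f k \<zeta>) \<le> 2 * t"
        using pos by (simp add: norm_mult norm_divide divide_simps mult_ac)
    qed
  qed simp
  with c have L: "(\<lambda>k. (?c k * K + (LINT \<zeta>|?Q. ?c k * ?f k \<zeta>)) / 2) \<longlonglongrightarrow>
      (0 * K + (LINT \<zeta>|?Q. indicator {l} \<zeta> *\<^sub>R (2 :: complex))) / 2"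
    by (intro tendsto_divide tendsto_add tendsto_mult tendsto_const) auto
  have I: "(LINT \<zeta>|?Q. indicator {l} \<zeta> *\<^sub>R (2 :: complex)) = 2 * cdot (\<mu> {l} *v x) x"
  proof -
    have "(LINT \<zeta>|?Q. indicator {l} \<zeta> *\<^sub>R (2::complex)) = measure ?Q {l} *\<^sub>R 2"
      using singleton_in_circle_borel
      by (intro has_bochner_integral_integral_eq has_bochner_integral_indicator)
        (auto simp: emeasure_eq_measure)
    then show ?thesis
      by (simp add: cdot_eq_measure_quad_measure[OF nonneg singleton_in_circle_borel]
          scaleR_conv_of_real)
  qed
  have eq: "?c k * cdot (G (Z k) *v x) x = (?c k * K + (LINT \<zeta>|?Q. ?c k * ?f k \<zeta>)) / 2" for k
    unfolding integral_mult_right_zero distrib_left[symmetric] G[symmetric] by simp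
  show ?thesis
    using L unfolding I eq by simp
qed

lemma nonneg_point: "nonneg_mat (\<mu> {l})"
  using nonneg singleton_in_circle_borel by (simp add: nonneg_mat_measure_def)

lemma point_self_adjoint: "cdot (\<mu> {l} *v x) y = cdot x (\<mu> {l} *v y)"
  by (simp add: cdot_vec_mat nonneg_mat_self_adjoint[OF nonneg_point])

text \<open>Passing to the adjoint conjugates the quadratic forms, and the limit form is real since
  \<open>\<mu> {l}\<close> is self-adjoint. Polarization turns convergence of the forms into
  convergence of the vectors.\<close>

lemma tendsto_cadj_G:
  assumes t: "t > 1" and Z: "\<And>k. Z k \<in> stolz t l" and lim: "Z \<longlonglongrightarrow> l"
  shows "(\<lambda>k. cnj (1 - cnj l * Z k) *s (cadj (G (Z k)) *v x)) \<longlonglongrightarrow> \<mu> {l} *v x"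
proof (rule tendsto_mat_vec_of_quad)
  fix x
  have "(\<lambda>k. cnj ((1 - cnj l * Z k) * cdot (G (Z k) *v x) x)) \<longlonglongrightarrow> cnj (cdot (\<mu> {l} *v x) x)"
    by (intro tendsto_cnj tendsto_quad_G[OF assms])
  then show "(\<lambda>k. cnj (1 - cnj l * Z k) * cdot (cadj (G (Z k)) *v x) x) \<longlonglongrightarrow> cdot (\<mu> {l} *v x) x"
    by (simp add: cnj_cdot point_self_adjoint flip: cdot_vec_mat)
qed

section \<open>Non-tangential limits of defect vectors\<close>

lemma defect_tendsto_iff:
  "((\<lambda>z. cadj (b z) *v e) \<circ> Z) \<longlonglongrightarrow> cadj \<alpha> *v e \<longleftrightarrow> (\<lambda>k. defect e (Z k)) \<longlonglongrightarrow> 0"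
  unfolding LIM_zero_iff[symmetric, of _ "cadj \<alpha> *v e"] tendsto_norm_zero_iff[symmetric, of "\<lambda>k. defect e (Z k)"]
  by (simp add: o_def norm_defect tendsto_norm_zero_iff)

text \<open>The limits are tested on sequences. That these avoid \<open>l\<close> is automatic,
  since a Stolz region lies in the open disc.\<close>

lemma S_set_iff:
  "e \<in> S_set b \<alpha> l \<longleftrightarrow>
    (\<forall>t>1. \<forall>Z. (\<forall>k. Z k \<in> stolz t l) \<longrightarrow> Z \<longlonglongrightarrow> l \<longrightarrow> (\<lambda>k. defect e (Z k)) \<longlonglongrightarrow> 0)"
proof -
  have "l \<notin> stolz t l" for t
    using l by (simp add: stolz_def)
  then show ?thesis
    by (simp add: S_set_def nt_tendsto_def tendsto_at_iff_sequentially defect_tendsto_iff)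
qed

text \<open>By \<open>tendsto_cadj_G\<close> the vectors \<open>y k\<close> approximate
  \<open>\<mu> {l} *v x\<close>, and their defects are exactly \<open>?c k *s x\<close>, which
  vanish in the limit. Contractivity of the adjoint of B controls the defect of the approximation
  error.\<close>

lemma point_mass_in_S_set: "\<mu> {l} *v x \<in> S_set b \<alpha> l"
  unfolding S_set_iff
proof (intro allI impI)
  fix t :: real and Z assume t: "t > 1" and Z: "\<forall>k. Z k \<in> stolz t l" and lim: "Z \<longlonglongrightarrow> l"
  let ?e = "\<mu> {l} *v x" and ?c = "\<lambda>k. cnj (1 - cnj l * Z k)"
  define y where "y k = ?c k *s (cadj (G (Z k)) *v x)" for k
  have ball: "Z k \<in> ball 0 1" for k
    using Z by (simp add: stolz_def)
  have c: "?c \<longlonglongrightarrow> 0"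
    using lim l complex_norm_square[of l] by (auto intro!: tendsto_eq_intros simp: mult.commute)
  have y: "y \<longlonglongrightarrow> ?e"
    using tendsto_cadj_G[OF t _ lim] Z by (simp add: y_def[abs_def])
  have bound: "norm (defect ?e (Z k)) \<le> 2 * norm (?e - y k) + norm (?c k) * norm x" for k
  proof -
    have "defect (c *s u) z = c *s defect u z" for c u z
      by (simp add: defect_def vector_scalar_commute vector_ssub_ldistrib)
    moreover have defect_diff: "defect (u - v) z = defect u z - defect v z" for u v z
      by (simp add: defect_def matrix_vector_mult_diff_distrib)
    ultimately have "defect (y k) (Z k) = ?c k *s x"
      by (simp only: y_def cadj_G_defect[OF ball])
    then have eq: "defect ?e (Z k) = defect (?e - y k) (Z k) + ?c k *s x"
      by (simp add: defect_diff)
    have "norm (defect (?e - y k) (Z k)) \<le> 2 * norm (?e - y k)"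
      using norm_triangle_ineq4[of "?e - y k" "cadj (B (Z k)) *v (?e - y k)"]
        norm_cadj_B_le[OF ball, of k "?e - y k"] by (simp add: defect_def)
    then show ?thesis
      using norm_triangle_ineq[of "defect (?e - y k) (Z k)" "?c k *s x"]
      unfolding eq norm_vector_scale by linarith
  qed
  have "(\<lambda>k. 2 * norm (?e - y k) + norm (?c k) * norm x) \<longlonglongrightarrow> 2 * norm (?e - ?e) + norm (0::complex) * norm x"
    by (intro tendsto_intros y c)
  then have "(\<lambda>k. 2 * norm (?e - y k) + norm (?c k) * norm x) \<longlonglongrightarrow> 0"
    by simp
  then show "(\<lambda>k. defect ?e (Z k)) \<longlonglongrightarrow> 0"
    by (rule Lim_null_comparison[rotated]) (use bound in auto)
qed

section \<open>The point mass and the Caratheodory condition\<close>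

lemma quotient_eq_integral:
  assumes "z \<in> ball 0 1"
  shows "integrable (quad_measure \<mu> (defect e z)) (\<lambda>\<zeta>. 1 / (norm (\<zeta> - z))\<^sup>2)"
    and "(LINT \<zeta>|quad_measure \<mu> (defect e z). 1 / (norm (\<zeta> - z))\<^sup>2)
      = ((norm e)\<^sup>2 - (norm (cadj (b z) *v e))\<^sup>2) / (1 - (norm z)\<^sup>2)"
  using poisson_integral_defect[OF assms, of e]
  by (auto simp: has_bochner_integral_iff)

text \<open>The integrand of the quotient is nonnegative, so the integral is at least the
  contribution of the atom at \<open>l\<close>.\<close>

lemma quotient_ge_point_mass:
  assumes z: "z \<in> ball 0 1"
  shows "Re (cdot (\<mu> {l} *v defect e z) (defect e z)) / (norm (l - z))\<^sup>2
    \<le> ((norm e)\<^sup>2 - (norm (cadj (b z) *v e))\<^sup>2) / (1 - (norm z)\<^sup>2)"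
proof -
  let ?Q = "quad_measure \<mu> (defect e z)"
  interpret finite_measure ?Q
    by (rule finite_measure_quad_measure[OF nonneg])
  have int: "has_bochner_integral ?Q (\<lambda>\<zeta>. indicator {l} \<zeta> *\<^sub>R (1 / (norm (l - z))\<^sup>2))
      (measure ?Q {l} *\<^sub>R (1 / (norm (l - z))\<^sup>2))"
    using singleton_in_circle_borel
    by (intro has_bochner_integral_indicator) (auto simp: emeasure_eq_measure)
  have "measure ?Q {l} *\<^sub>R (1 / (norm (l - z))\<^sup>2) \<le> (LINT \<zeta>|?Q. 1 / (norm (\<zeta> - z))\<^sup>2)"
    unfolding has_bochner_integral_integral_eq[OF int, symmetric]
    by (intro integral_mono integrable.intros[OF int]
        quotient_eq_integral(1)[OF z]) (auto simp: indicator_def)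
  then show ?thesis
    using quotient_eq_integral(2)[OF z, of e]
    by (simp add: measure_quad_measure[OF nonneg singleton_in_circle_borel])
qed

text \<open>With \<open>e = \<mu>{l} x\<close> the numerator is at most \<open>2 Re \<langle>\<mu>{l} x, e - B(z)* e\<rangle>\<close>, which the Cauchy--Schwarz
  inequality for \<open>\<mu>{l}\<close> bounds by a multiple of \<open>\<langle>\<mu>{l} x, x\<rangle>\<close> plus half of the numerator.\<close>

lemma quotient_point_mass_le:
  assumes z: "z \<in> ball 0 1"
  shows "((norm (\<mu> {l} *v x))\<^sup>2 - (norm (cadj (b z) *v (\<mu> {l} *v x)))\<^sup>2) / (1 - (norm z)\<^sup>2)
    \<le> 4 * (norm (l - z) / (1 - (norm z)\<^sup>2))\<^sup>2 * Re (cdot (\<mu> {l} *v x) x)"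
proof -
  let ?e = "\<mu> {l} *v x"
  define d where "d = defect ?e z"
  define r where "r = norm (l - z)"
  define p where "p = 1 - (norm z)\<^sup>2"
  define D where "D = (norm ?e)\<^sup>2 - (norm (cadj (b z) *v ?e))\<^sup>2"
  define m where "m = Re (cdot ?e x)"
  have r: "r > 0"
    using z l by (auto simp: r_def)
  have p: "p > 0"
    using z by (simp add: p_def power_less_one_iff)
  have "Re (cdot (\<mu> {l} *v d) d) / r\<^sup>2 \<le> D / p"
    using quotient_ge_point_mass[OF z, of ?e] by (simp add: D_def d_def r_def p_def)
  then have d: "Re (cdot (\<mu> {l} *v d) d) \<le> r\<^sup>2 * D / p"
    using r by (simp add: field_simps)
  \<comment> \<open>This \<open>s\<close> makes the last term equal to \<open>D / 2\<close>, which
    the left side absorbs.\<close>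
  define s where "s = 2 * r\<^sup>2 / p"
  have s: "s > 0"
    using r p by (simp add: s_def)
  have "D \<le> 2 * Re (cdot ?e d)"
    using defect_le[of ?e z] by (simp add: D_def d_def)
  also have "\<dots> \<le> s * m + 1 / s * Re (cdot (\<mu> {l} *v d) d)"
    using nonneg_mat_cauchy_schwarz[OF nonneg_point s, of 1 x d] by (simp add: m_def)
  also have "\<dots> \<le> s * m + 1 / s * (r\<^sup>2 * D / p)"
    using d s by (intro add_left_mono mult_left_mono) auto
  also have "\<dots> = s * m + D / 2"
    using r p by (simp add: s_def)
  finally have "D \<le> 2 * s * m"
    by simp
  then have "D / p \<le> 2 * s * m / p"
    using p by (intro divide_right_mono) auto
  also have "\<dots> = 4 * (r / p)\<^sup>2 * m"
    by (simp add: s_def power2_eq_square)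
  finally show ?thesis
    by (simp add: D_def p_def r_def m_def)
qed

text \<open>One sequence suffices, and a radial one has |l - z| = 1 - |z|, so the factor |l - z| /
  (1 - |z|^2) in \<open>quotient_point_mass_le\<close> is at most 1.\<close>

lemma caratheodory_point_mass: "caratheodory b l (\<mu> {l} *v x)"
  unfolding caratheodory_def
proof (intro exI conjI allI)
  let ?m = "Re (cdot (\<mu> {l} *v x) x)"
  \<comment> \<open>The double \<open>Suc\<close> starts the radii at 1/2, so that all of them are
    positive.\<close>
  define \<rho> where "\<rho> k = 1 - inverse (real (Suc (Suc k)))" for k
  define Z where "Z k = complex_of_real (\<rho> k) * l" for k
  have \<rho>: "0 < \<rho> k" "\<rho> k < 1" for k
    by (simp_all add: \<rho>_def field_simps)
  have norm_Z: "norm (Z k) = \<rho> k" for k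
    using \<rho>[of k] l by (simp add: Z_def norm_mult)
  have dist: "norm (l - Z k) = 1 - \<rho> k" for k
  proof -
    have "l - Z k = complex_of_real (1 - \<rho> k) * l"
      by (simp add: Z_def algebra_simps)
    then have "norm (l - Z k) = \<bar>1 - \<rho> k\<bar> * norm l"
      by (simp only: norm_mult norm_of_real)
    then show ?thesis
      using \<rho>[of k] l by simp
  qed
  have ball: "Z k \<in> ball 0 1" for k
    using \<rho> by (simp add: norm_Z)
  show "(2::real) > 1"
    by simp
  show "Z k \<in> stolz 2 l" for k
    using \<rho>[of k] ball[of k] dist[of k] by (simp add: stolz_def norm_Z norm_minus_commute)
  have "\<rho> \<longlonglongrightarrow> 1 - 0"
    unfolding \<rho>_def[abs_def]
    by (intro tendsto_diff tendsto_const LIMSEQ_Suc[OF LIMSEQ_inverse_real_of_nat])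
  then have "Z \<longlonglongrightarrow> complex_of_real 1 * l"
    unfolding Z_def[abs_def] by (intro tendsto_mult tendsto_of_real tendsto_const) simp
  then show "Z \<longlonglongrightarrow> l"
    by simp
  let ?q = "\<lambda>k. ((norm (\<mu> {l} *v x))\<^sup>2 - (norm (cadj (b (Z k)) *v (\<mu> {l} *v x)))\<^sup>2) / (1 - (norm (Z k))\<^sup>2)"
  have m: "?m \<ge> 0"
    using nonneg_point by (simp add: nonneg_mat_def complex_nonneg_Reals_iff)
  have "norm (?q k) \<le> 4 * ?m" for k
  proof -
    have "?q k \<ge> 0"
      unfolding quotient_eq_integral(2)[OF ball[of k], symmetric]
      by (rule Bochner_Integration.integral_nonneg) simp
    moreover have "?q k \<le> 4 * ?m"
    proof -
      have "(\<rho> k)\<^sup>2 \<le> \<rho> k"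
        using \<rho>[of k] by (simp add: power2_eq_square mult_left_le)
      then have "norm (l - Z k) / (1 - (norm (Z k))\<^sup>2) \<le> 1" "norm (l - Z k) / (1 - (norm (Z k))\<^sup>2) \<ge> 0"
        using \<rho>[of k] unfolding dist norm_Z by (simp_all add: divide_simps)
      then have "(norm (l - Z k) / (1 - (norm (Z k))\<^sup>2))\<^sup>2 \<le> 1"
        by (simp add: power_le_one)
      then have "4 * (norm (l - Z k) / (1 - (norm (Z k))\<^sup>2))\<^sup>2 * ?m \<le> 4 * 1 * ?m"
        using m by (intro mult_right_mono mult_left_mono) auto
      then show ?thesis
        using quotient_point_mass_le[OF ball[of k], of x] by simp
    qed
    ultimately show ?thesis
      unfolding real_norm_def by linarith
  qed
  then show "bounded (range ?q)"
    by (auto intro!: boundedI)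
qed

text \<open>The mass that \<open>\<mu>\<close> gives to the kernel vector \<open>w\<close> vanishes near \<open>l\<close>, while away from \<open>l\<close> the
  Herglotz kernel stays bounded and the defect vectors tend to zero; the weight balances the two
  regions.\<close>

lemma E_set_orthogonal_kernel:
  assumes e: "e \<in> E_set b \<alpha> l" and w: "\<mu> {l} *v w = 0"
  shows "w \<bullet> e \<le> 0"
proof -
  let ?S = "sphere 0 1 :: complex set"
  let ?q = "\<lambda>z. ((norm e)\<^sup>2 - (norm (cadj (b z) *v e))\<^sup>2) / (1 - (norm z)\<^sup>2)"
  obtain t Z where t: "t > 1" and Z: "\<And>k. Z k \<in> stolz t l" and lim: "Z \<longlonglongrightarrow> l"
    and "bounded (range (\<lambda>k. ?q (Z k)))"
    using e by (auto simp: E_set_def caratheodory_def)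
  then obtain C where "\<And>k. norm (?q (Z k)) \<le> C"
    unfolding bounded_iff by blast
  then have C: "?q (Z k) \<le> C" for k
    by (metis abs_le_D1 real_norm_def)
  define X where "X k = defect e (Z k)" for k
  have X: "X \<longlonglongrightarrow> 0"
    using e t Z lim by (auto simp: E_set_def S_set_iff X_def[abs_def])
  have ball: "Z k \<in> ball 0 1" for k
    using Z[of k] by (simp add: stolz_def)
  \<comment> \<open>\<open>u\<close> is the part of 2 G w that does not depend on the point; its
    pairing with the defects tends to zero.\<close>
  define u where "u = \<i> *s (Im_mat (H_fun b \<alpha> 0) *v w) + w"
  define MS where "MS = measure (quad_measure \<mu> w) ?S"
  define N where "N n = cball l (inverse (real (Suc n))) \<inter> ?S" for n
  have N: "N n \<in> sets circle_borel" for n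
    by (auto simp: N_def sets_restrict_space)
  \<comment> \<open>The parameter \<open>c\<close> stays free: first \<open>n\<close> tends to
    infinity, which removes the mass of \<open>N n\<close>, and then \<open>c\<close> tends to
    0.\<close>
  have est: "4 * (w \<bullet> e) \<le> c * (MS + 4 * C) + measure (quad_measure \<mu> w) (N n) / c"
    if c: "c > 0" for c n
  proof -
    define \<delta> where "\<delta> = inverse (real (Suc n))"
    \<comment> \<open>On the arc \<open>N n\<close> the weight is at least \<open>1 / c\<close>,
      which leaves \<open>c\<close> times an integrand controlled by the Caratheodory quotient. Off
      the arc the weight is \<open>c\<close>.\<close>
    define W where "W \<zeta> = c + indicator (N n) \<zeta> / c" for \<zeta> :: complex
    \<comment> \<open>\<open>R\<close> is (2 / (\<delta> / 2))^2 / c: off the arc the kernel has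
      numerator at most 2 and denominator at least \<delta> / 2 in modulus.\<close>
    define R where "R = 16 / (\<delta>\<^sup>2 * c)"
    have \<delta>: "\<delta> > 0"
      by (simp add: \<delta>_def)
    have W_pos: "W \<zeta> > 0" for \<zeta>
      using c by (simp add: W_def add_pos_nonneg)
    have W: "simple_function circle_borel W"
      unfolding W_def[abs_def] divide_inverse
      by (intro simple_function_add simple_function_mult simple_function_const
          simple_function_indicator N)
    have W_int: "(LINT \<zeta>|quad_measure \<mu> w. W \<zeta>) = c * MS + measure (quad_measure \<mu> w) (N n) / c"
    proof -
      interpret finite_measure "quad_measure \<mu> w"
        by (rule finite_measure_quad_measure[OF nonneg])
      have "integrable (quad_measure \<mu> w) (\<lambda>\<zeta>. indicator (N n) \<zeta> / c)"
        using N by (intro integrable_divide_zero integrable_real_indicator) (auto simp: emeasure_eq_measure)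
      moreover have "N n \<inter> ?S = N n"
        by (auto simp: N_def)
      ultimately show ?thesis
        unfolding W_def MS_def by (subst Bochner_Integration.integral_add) simp_all
    qed
    have "\<forall>\<^sub>F k in sequentially. dist (Z k) l < \<delta> / 2"
      using lim \<delta> by (intro tendstoD) auto
    then have ev: "\<forall>\<^sub>F k in sequentially. 4 * (w \<bullet> e)
        \<le> 2 * (u \<bullet> X k) + (c * MS + measure (quad_measure \<mu> w) (N n) / c)
          + (4 * c * C + R * (X k \<bullet> (\<mu> ?S *v X k)))"
    proof (rule eventually_mono)
      fix k assume near: "dist (Z k) l < \<delta> / 2"
      let ?f = "\<lambda>\<zeta>. (\<zeta> + Z k) / (\<zeta> - Z k)" and ?Q = "quad_measure \<mu> (X k)"
      let ?g = "\<lambda>\<zeta>. 4 * c * (1 / (norm (\<zeta> - Z k))\<^sup>2) + R"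
      interpret finite_measure ?Q
        by (rule finite_measure_quad_measure[OF nonneg])
      obtain J where J: "has_mat_integral \<mu> ?f J"
        and H: "\<And>x. H_fun b \<alpha> (Z k) *v x = \<i> *s (Im_mat (H_fun b \<alpha> 0) *v x) + J *v x"
        using herglotz[OF ball] by metis
      have le_g: "(norm (?f \<zeta>))\<^sup>2 / W \<zeta> \<le> ?g \<zeta>" if \<zeta>: "norm \<zeta> = 1" for \<zeta>
      proof -
        have pos: "norm (\<zeta> - Z k) > 0"
          using \<zeta> ball[of k] by auto
        have "norm (\<zeta> + Z k) \<le> 2"
          using norm_triangle_ineq[of \<zeta> "Z k"] \<zeta> ball[of k] by simp
        then have "(norm (\<zeta> + Z k))\<^sup>2 \<le> 2\<^sup>2"
          by (intro power_mono) auto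
        then have f: "(norm (?f \<zeta>))\<^sup>2 \<le> 4 * (1 / (norm (\<zeta> - Z k))\<^sup>2)"
          using pos by (simp add: norm_divide power_divide divide_right_mono)
        show ?thesis
        proof (cases "\<zeta> \<in> N n")
          case True
          then have "1 / c \<le> W \<zeta>"
            using c by (simp add: W_def)
          then have "(norm (?f \<zeta>))\<^sup>2 / W \<zeta> \<le> (norm (?f \<zeta>))\<^sup>2 / (1 / c)"
            using c W_pos[of \<zeta>] by (intro divide_left_mono) auto
          also have "\<dots> \<le> c * (4 * (1 / (norm (\<zeta> - Z k))\<^sup>2))"
            using mult_left_mono[OF f, of c] c by (simp add: mult.commute)
          also have "\<dots> \<le> ?g \<zeta>"
            using c by (simp add: R_def mult.commute)
          finally show ?thesis .
        next
          case False
          then have "dist l \<zeta> > \<delta>"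
            using \<zeta> by (simp add: N_def \<delta>_def)
          then have "\<delta> / 2 \<le> norm (\<zeta> - Z k)"
            using near dist_triangle[of l \<zeta> "Z k"] by (simp add: dist_commute dist_norm)
          then have "(\<delta> / 2)\<^sup>2 \<le> (norm (\<zeta> - Z k))\<^sup>2"
            using \<delta> by (intro power_mono) auto
          then have "1 / (norm (\<zeta> - Z k))\<^sup>2 \<le> 1 / (\<delta> / 2)\<^sup>2"
            using \<delta> pos by (intro divide_left_mono) auto
          then have "(norm (?f \<zeta>))\<^sup>2 \<le> 4 * (1 / (\<delta> / 2)\<^sup>2)"
            using f by linarith
          moreover have "W \<zeta> = c"
            using False by (simp add: W_def)
          ultimately have "(norm (?f \<zeta>))\<^sup>2 / W \<zeta> \<le> 4 * (1 / (\<delta> / 2)\<^sup>2) / c"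
            using c by (simp only: divide_right_mono less_imp_le)
          also have "\<dots> = R"
            by (simp add: R_def power2_eq_square)
          also have "\<dots> \<le> ?g \<zeta>"
            using c by simp
          finally show ?thesis .
        qed
      qed
      note quotient = quotient_eq_integral[OF ball[of k], of e, folded X_def]
      have g: "integrable ?Q ?g"
        by (intro Bochner_Integration.integrable_add integrable_const
            integrable_mult_right[OF quotient(1)])
      have int: "integrable ?Q (\<lambda>\<zeta>. (norm (?f \<zeta>))\<^sup>2 / W \<zeta>)"
      proof (rule Bochner_Integration.integrable_bound[OF g])
        have 1: "W \<in> borel_measurable ?Q"
          using borel_measurable_simple_function[OF W] by (simp cong: measurable_cong_sets)
        have 2: "?f \<in> borel_measurable ?Q"
          using J by (auto simp: has_mat_integral_def dest: borel_measurable_integrable)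
        show "(\<lambda>\<zeta>. (norm (?f \<zeta>))\<^sup>2 / W \<zeta>) \<in> borel_measurable ?Q"
          by (rule borel_measurable_divide[OF borel_measurable_power[OF
                  measurable_compose[OF 2 borel_measurable_norm]] 1])
        show "AE \<zeta> in ?Q. norm ((norm (?f \<zeta>))\<^sup>2 / W \<zeta>) \<le> norm (?g \<zeta>)"
        proof (rule AE_I2)
          fix \<zeta> assume "\<zeta> \<in> space ?Q"
          then have "(norm (?f \<zeta>))\<^sup>2 / W \<zeta> \<le> ?g \<zeta>"
            by (intro le_g) simp
          moreover have "0 \<le> (norm (?f \<zeta>))\<^sup>2 / W \<zeta>"
            using W_pos[of \<zeta>] by (simp add: less_imp_le)
          ultimately show "norm ((norm (?f \<zeta>))\<^sup>2 / W \<zeta>) \<le> norm (?g \<zeta>)"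
            unfolding real_norm_def by linarith
        qed
      qed
      \<comment> \<open>Since \<open>cadj (G (Z k))\<close> maps the defect to \<open>e\<close>, <w,
        e> becomes <G w, d>, and 2 G = H + I brings in the Herglotz integral.\<close>
      have "2 * cdot w e = 2 * cdot (G (Z k) *v w) (X k)"
        by (simp add: cdot_mat_vec X_def cadj_G_defect[OF ball])
      also have "\<dots> = cdot (H_fun b \<alpha> (Z k) *v w + w) (X k)"
        by (simp add: H_eq_G[OF ball] cdot_simps)
      also have "\<dots> = cdot u (X k) + cdot (J *v w) (X k)"
        by (simp add: H u_def cdot_simps)
      finally have "Re (2 * cdot w e) = Re (cdot u (X k) + cdot (J *v w) (X k))"
        by (rule arg_cong)
      then have "4 * (w \<bullet> e) = 2 * (u \<bullet> X k) + 2 * Re (cdot (J *v w) (X k))"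
        by (simp add: inner_eq_Re_cdot)
      moreover have "2 * Re (cdot (J *v w) (X k))
          \<le> (LINT \<zeta>|quad_measure \<mu> w. W \<zeta>) + (LINT \<zeta>|?Q. (norm (?f \<zeta>))\<^sup>2 / W \<zeta>)"
        by (rule mat_integral_weighted_cauchy_schwarz[OF nonneg J W W_pos int])
      moreover have "(LINT \<zeta>|?Q. (norm (?f \<zeta>))\<^sup>2 / W \<zeta>) \<le> (LINT \<zeta>|?Q. ?g \<zeta>)"
        using le_g by (intro integral_mono int g) simp
      moreover have "(LINT \<zeta>|?Q. ?g \<zeta>) = 4 * c * ?q (Z k) + R * (X k \<bullet> (\<mu> ?S *v X k))"
      proof -
        have "(LINT \<zeta>|?Q. ?g \<zeta>) = 4 * c * (LINT \<zeta>|?Q. 1 / (norm (\<zeta> - Z k))\<^sup>2) + R * measure ?Q ?S"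
          unfolding Bochner_Integration.integral_add[OF integrable_mult_right[OF quotient(1)]
              integrable_const] integral_mult_right_zero
          by simp
        moreover have "measure ?Q ?S = X k \<bullet> (\<mu> ?S *v X k)"
          by (simp add: measure_quad_measure[OF nonneg sphere_in_circle_borel]
              inner_commute flip: inner_eq_Re_cdot)
        ultimately show ?thesis
          by (simp only: quotient(2))
      qed
      moreover have "4 * c * ?q (Z k) \<le> 4 * c * C"
        using C[of k] c by (intro mult_left_mono) auto
      ultimately show "4 * (w \<bullet> e)
        \<le> 2 * (u \<bullet> X k) + (c * MS + measure (quad_measure \<mu> w) (N n) / c)
          + (4 * c * C + R * (X k \<bullet> (\<mu> ?S *v X k)))"
        unfolding W_int by linarith
    qed
    \<comment> \<open>For fixed \<open>c\<close> and \<open>n\<close> all terms containing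
      \<open>X k\<close> vanish as \<open>k\<close> grows.\<close>
    have "(\<lambda>k. \<mu> ?S *v X k) \<longlonglongrightarrow> \<mu> ?S *v 0"
      by (rule bounded_linear.tendsto[OF matrix_vector_mul_bounded_linear X])
    then have "(\<lambda>k. 2 * (u \<bullet> X k) + (c * MS + measure (quad_measure \<mu> w) (N n) / c)
          + (4 * c * C + R * (X k \<bullet> (\<mu> ?S *v X k))))
      \<longlonglongrightarrow> 2 * (u \<bullet> 0) + (c * MS + measure (quad_measure \<mu> w) (N n) / c)
          + (4 * c * C + R * (0 \<bullet> (\<mu> ?S *v 0)))"
      by (intro tendsto_intros X)
    from tendsto_lowerbound[OF this ev] show ?thesis
      by (simp add: algebra_simps)
  qed
  \<comment> \<open>Continuity from above: the arcs decrease to the singleton of \<open>l\<close>,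
    which is null for the scalar measure of \<open>w\<close>.\<close>
  have "(\<lambda>n. measure (quad_measure \<mu> w) (N n)) \<longlonglongrightarrow> measure (quad_measure \<mu> w) (\<Inter>n. N n)"
  proof -
    interpret finite_measure "quad_measure \<mu> w"
      by (rule finite_measure_quad_measure[OF nonneg])
    have "decseq N"
    proof (rule decseq_SucI)
      fix n
      have "inverse (real (Suc (Suc n))) \<le> inverse (real (Suc n))"
        by simp
      then show "N (Suc n) \<le> N n"
        unfolding N_def by (intro Int_mono subset_cball order_refl)
    qed
    then show ?thesis
      using N by (intro finite_Lim_measure_decseq) auto
  qed
  moreover have "(\<Inter>n. N n) = {l}"
  proof -
    have "\<zeta> = l" if "\<forall>n. dist l \<zeta> \<le> inverse (real (Suc n))" for \<zeta>
    proof -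
      have "dist l \<zeta> \<le> 0"
        using that by (intro LIMSEQ_le_const[OF LIMSEQ_inverse_real_of_nat]) blast
      then show ?thesis by simp
    qed
    then show ?thesis
      using l by (auto simp: N_def)
  qed
  moreover have "measure (quad_measure \<mu> w) {l} = 0"
    by (simp add: measure_quad_measure[OF nonneg singleton_in_circle_borel] w cdot_def)
  ultimately have mass: "(\<lambda>n. measure (quad_measure \<mu> w) (N n)) \<longlonglongrightarrow> 0"
    by simp
  have "4 * (w \<bullet> e) \<le> c * (MS + 4 * C)" if c: "c > 0" for c
  proof -
    have "(\<lambda>n. c * (MS + 4 * C) + measure (quad_measure \<mu> w) (N n) / c) \<longlonglongrightarrow> c * (MS + 4 * C) + 0 / c"
      using c by (intro tendsto_intros mass) auto
    then show ?thesis
      using est[OF c] LIMSEQ_le_const by fastforce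
  qed
  \<comment> \<open>The choice \<open>c = inverse (real (Suc n))\<close> sends \<open>c\<close> to
    0.\<close>
  then have "4 * (w \<bullet> e) \<le> inverse (real (Suc n)) * (MS + 4 * C)" for n
    by simp
  moreover have "(\<lambda>n. inverse (real (Suc n)) * (MS + 4 * C)) \<longlonglongrightarrow> 0 * (MS + 4 * C)"
    by (intro tendsto_intros LIMSEQ_inverse_real_of_nat)
  ultimately have "4 * (w \<bullet> e) \<le> 0 * (MS + 4 * C)"
    using LIMSEQ_le_const by blast
  then show ?thesis
    by simp
qed

text \<open>Split \<open>e\<close> into \<open>y\<close> in the range and \<open>w\<close>
  orthogonal to it. Self-adjointness of \<open>\<mu> {l}\<close> puts \<open>w\<close> into its
  kernel, so |w|^2 = <w, e> \<le> 0 by \<open>E_set_orthogonal_kernel\<close>.\<close>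

lemma E_set_subset_range:
  assumes e: "e \<in> E_set b \<alpha> l"
  shows "e \<in> range ((*v) (\<mu> {l}))"
proof -
  have "linear ((*v) (\<mu> {l}))"
    by (simp add: bounded_linear.linear)
  then have sub: "subspace (range ((*v) (\<mu> {l})))"
    by (simp add: linear_subspace_image)
  obtain y w where y: "y \<in> span (range ((*v) (\<mu> {l})))"
    and w: "\<And>v. v \<in> span (range ((*v) (\<mu> {l}))) \<Longrightarrow> orthogonal w v" and eq: "e = y + w"
    using orthogonal_subspace_decomp_exists by blast
  have y': "y \<in> range ((*v) (\<mu> {l}))"
    using y sub by (simp only: span_eq_iff[THEN iffD2])
  have "(\<mu> {l} *v w) \<bullet> (\<mu> {l} *v w) = w \<bullet> (\<mu> {l} *v (\<mu> {l} *v w))"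
    by (simp add: inner_eq_Re_cdot point_self_adjoint)
  also have "\<dots> = 0"
    using w by (auto simp: orthogonal_def intro: span_base)
  finally have "w \<bullet> e \<le> 0"
    using E_set_orthogonal_kernel[OF e] by simp
  moreover have "w \<bullet> y = 0"
    using w[OF y] by (simp add: orthogonal_def)
  ultimately have "w = 0"
    using inner_ge_zero[of w] by (simp add: eq inner_add_right order_antisym)
  then show ?thesis
    using y' eq by simp
qed

end

theorem theorem8p3:
  fixes b :: "complex \<Rightarrow> complex ^ 'n ^ 'n"
    and \<alpha> :: "complex ^ 'n ^ 'n"
    and \<mu> :: "complex set \<Rightarrow> complex ^ 'n ^ 'n"
    and l :: complex
  assumes "schur_class b"
    and "unitary \<alpha>"
    and "l \<in> sphere 0 1"
    and "AC_measure b \<alpha> \<mu>"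
  shows "range ((*v) (\<mu> {l})) = E_set b \<alpha> l"
proof -
  interpret clark b \<alpha> \<mu> l
    using assms by unfold_locales auto
  show ?thesis
    using E_set_subset_range point_mass_in_S_set caratheodory_point_mass
    by (auto simp: E_set_def)
qed
end
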